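(* Let $G$ be a finite simple connected graph with $n$ vertices and $m$ edges. Then $$\begin{aligned}F(G^{-+-})={}&(3n-20)F(G)+(3n^2-12n+12m+36)M_1(G)+6(n-4)M_2(G)+\xi_4(G)\\&+3\,\mathrm{ReZG}_3(G)+(m+n-1)^2\{n(m+n-1)-12m\}+m(n-4)^3.\end{aligned}$$
   Context: For a finite simple graph $H$ with vertex set $V(H)$ and edge set $E(H)$, $d_H(v)$ denotes the degree of the vertex $v$ in $H$. The F-index of $H$ is $F(H)=\sum_{v\in V(H)} d_H(v)^3$. The first and second Zagreb indices are $M_1(H)=\sum_{v\in V(H)} d_H(v)^2$ and $M_2(H)=\sum_{uv\in E(H)} d_H(u)d_H(v)$. Further, $\xi_4(H)=\sum_{v\in V(H)} d_H(v)^4=\sum_{uv\in E(H)}[d_H(u)^3+d_H(v)^3]$ and $\mathrm{ReZG}_3(H)=\sum_{uv\in E(H)} d_H(u)d_H(v)[d_H(u)+d_H(v)]$. For $x,y,z\in\{+,-\}$, the total transformation graph $G^{xyz}$ is the simple graph with vertex set $V(G)\cup E(G)$ (disjoint union) in which two distinct elements $u,v$ are adjacent if and only if one of the following holds: (i) $u,v\in V(G)$, and $u,v$ are adjacent in $G$ if $x=+$, respectively not adjacent in $G$ if $x=-$; (ii) $u,v\in E(G)$, and $u,v$ are adjacent in $G$ (share an endpoint) if $y=+$, respectively not adjacent in $G$ if $y=-$; (iii) one of them is a vertex of $G$ and the other is an edge of $G$, and they are incident in $G$ if $z=+$, respectively not incident in $G$ if $z=-$. *)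

theory Defs
  imports Main
begin

record 'a graph =
  verts :: "'a set"
  edges :: "'a set set"

definition finite_simple_graph :: "'a graph \<Rightarrow> bool" where
  "finite_simple_graph H \<longleftrightarrow>
     finite (verts H) \<and> (\<forall>e\<in>edges H. e \<subseteq> verts H \<and> card e = 2)"

definition adjacent :: "'a graph \<Rightarrow> 'a \<Rightarrow> 'a \<Rightarrow> bool" where
  "adjacent H u v \<longleftrightarrow> {u, v} \<in> edges H"

text \<open>The graph without vertices also counts as connected here.\<close>

definition connected_graph :: "'a graph \<Rightarrow> bool" where
  "connected_graph H \<longleftrightarrow>
     (\<forall>u\<in>verts H. \<forall>v\<in>verts H. (adjacent H)\<^sup>*\<^sup>* u v)"

definition degree :: "'a graph \<Rightarrow> 'a \<Rightarrow> nat" where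
  "degree H v = card {e \<in> edges H. v \<in> e}"

definition F_index :: "'a graph \<Rightarrow> nat" where
  "F_index H = (\<Sum>v\<in>verts H. degree H v ^ 3)"

definition M1 :: "'a graph \<Rightarrow> nat" where
  "M1 H = (\<Sum>v\<in>verts H. degree H v ^ 2)"

text \<open>An edge is a two-element set \<open>e = {u, v}\<close>, so a product or sum over \<open>w \<in> e\<close>
  has exactly the two terms for \<open>u\<close> and \<open>v\<close>.\<close>

definition M2 :: "'a graph \<Rightarrow> nat" where
  "M2 H = (\<Sum>e\<in>edges H. \<Prod>w\<in>e. degree H w)"

definition xi4 :: "'a graph \<Rightarrow> nat" where
  "xi4 H = (\<Sum>v\<in>verts H. degree H v ^ 4)"

definition ReZG3 :: "'a graph \<Rightarrow> nat" where
  "ReZG3 H = (\<Sum>e\<in>edges H. (\<Prod>w\<in>e. degree H w) * (\<Sum>w\<in>e. degree H w))"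

datatype sign = Plus | Minus

fun signed :: "sign \<Rightarrow> bool \<Rightarrow> bool" where
  "signed Plus P = P"
| "signed Minus P = (\<not> P)"

text \<open>Adjacency in the total transformation graph, meaningful only for distinct arguments:
  distinctness is imposed in \<open>total_transformation\<close>.\<close>

fun transformation_adj ::
  "'a graph \<Rightarrow> sign \<Rightarrow> sign \<Rightarrow> sign \<Rightarrow> 'a + 'a set \<Rightarrow> 'a + 'a set \<Rightarrow> bool" where
  "transformation_adj G x y z (Inl u) (Inl v) = signed x (adjacent G u v)"
| "transformation_adj G x y z (Inr e) (Inr f) = signed y (e \<inter> f \<noteq> {})"
| "transformation_adj G x y z (Inl v) (Inr e) = signed z (v \<in> e)"
| "transformation_adj G x y z (Inr e) (Inl v) = signed z (v \<in> e)"

definition total_transformation ::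
  "'a graph \<Rightarrow> sign \<Rightarrow> sign \<Rightarrow> sign \<Rightarrow> ('a + 'a set) graph" where
  "total_transformation G x y z =
     \<lparr>verts = verts G <+> edges G,
      edges = {{a, b} | a b. a \<in> verts G <+> edges G \<and> b \<in> verts G <+> edges G \<and>
                 a \<noteq> b \<and> transformation_adj G x y z a b}\<rparr>"

lemma finite_simple_graph_total_transformation:
  assumes "finite_simple_graph G"
  shows "finite_simple_graph (total_transformation G x y z)"
proof -
  have "edges G \<subseteq> Pow (verts G)" "finite (verts G)"
    using assms by (auto simp: finite_simple_graph_def)
  then have "finite (edges G)"
    by (meson finite_Pow_iff finite_subset)
  with \<open>finite (verts G)\<close> show ?thesis
    unfolding finite_simple_graph_def total_transformation_def
    by (auto simp: card_2_iff)
qed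

lemma transformation_adj_sym:
  "transformation_adj G x y z a b \<longleftrightarrow> transformation_adj G x y z b a"
  by (cases a; cases b) (auto simp: adjacent_def insert_commute Int_commute)

lemma adjacent_total_transformation:
  "adjacent (total_transformation G x y z) a b \<longleftrightarrow>
     a \<in> verts G <+> edges G \<and> b \<in> verts G <+> edges G \<and> a \<noteq> b \<and>
     transformation_adj G x y z a b"
proof
  assume "adjacent (total_transformation G x y z) a b"
  then obtain c d where "{a, b} = {c, d}" "c \<in> verts G <+> edges G" "d \<in> verts G <+> edges G"
      "c \<noteq> d" "transformation_adj G x y z c d"
    unfolding adjacent_def total_transformation_def by (simp only: graph.simps mem_Collect_eq) blast
  then show "a \<in> verts G <+> edges G \<and> b \<in> verts G <+> edges G \<and> a \<noteq> b \<and>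
     transformation_adj G x y z a b"
    using transformation_adj_sym unfolding doubleton_eq_iff by metis
next
  assume "a \<in> verts G <+> edges G \<and> b \<in> verts G <+> edges G \<and> a \<noteq> b \<and>
     transformation_adj G x y z a b"
  then show "adjacent (total_transformation G x y z) a b"
    unfolding adjacent_def total_transformation_def
    by (simp only: graph.simps mem_Collect_eq) blast
qed

end

theory Submission
  imports Defs
begin

text \<open>In \<open>G\<^sup>-\<^sup>+\<^sup>-\<close> a vertex \<open>v\<close> has degree \<open>n + m - 1 - 2 d(v)\<close> and an edge \<open>uv\<close> has degree
  \<open>d(u) + d(v) + n - 4\<close>. Expand the cubes of both and collect terms; a sum of
  \<open>g(u) + g(v)\<close> over the edges \<open>uv\<close> equals the sum of \<open>d(v) g(v)\<close> over the vertices, which turns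
  power sums over edges into vertex indices of one degree higher.\<close>

lemma finite_edges:
  assumes "finite_simple_graph H"
  shows "finite (edges H)"
proof (rule finite_subset)
  show "edges H \<subseteq> Pow (verts H)" "finite (Pow (verts H))"
    using assms by (auto simp: finite_simple_graph_def)
qed

lemma edge_eq_doubleton:
  assumes "finite_simple_graph H" "e \<in> edges H" "v \<in> e"
  obtains u where "e = {v, u}" "u \<noteq> v"
proof -
  have "card e = 2"
    using assms by (auto simp: finite_simple_graph_def)
  then obtain x y where "e = {x, y}" "x \<noteq> y"
    by (auto simp: card_2_iff)
  with \<open>v \<in> e\<close> show thesis
    using that[of x] that[of y] by auto
qed

lemma not_adjacent_self: "finite_simple_graph H \<Longrightarrow> \<not> adjacent H v v"
  by (auto simp: finite_simple_graph_def adjacent_def dest: bspec[where x = "{v}"])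

lemma adjacent_in_verts: "finite_simple_graph H \<Longrightarrow> adjacent H u v \<Longrightarrow> v \<in> verts H"
  by (auto simp: finite_simple_graph_def adjacent_def)

text \<open>Pairing a neighbour \<open>u\<close> with the edge \<open>{v, u}\<close> is a bijection.
  It lets degrees in the transformation graph be counted from its adjacency relation, which is
  easier to describe than its set of edges.\<close>

lemma degree_eq_card_neighbours:
  assumes "finite_simple_graph H"
  shows "degree H v = card {u. adjacent H v u}"
proof -
  have "inj_on (\<lambda>u. {v, u}) {u. adjacent H v u}"
    by (auto simp: inj_on_def doubleton_eq_iff)
  moreover have "(\<lambda>u. {v, u}) ` {u. adjacent H v u} = {e \<in> edges H. v \<in> e}"
  proof (intro equalityI subsetI)
    fix e assume e: "e \<in> {e \<in> edges H. v \<in> e}"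
    then obtain u where "e = {v, u}"
      using edge_eq_doubleton[OF assms, of e v] by auto
    with e show "e \<in> (\<lambda>u. {v, u}) ` {u. adjacent H v u}"
      by (auto simp: adjacent_def)
  qed (auto simp: adjacent_def)
  ultimately show ?thesis
    unfolding degree_def by (metis card_image)
qed

text \<open>Double counting of incident pairs: after exchanging the sums, \<open>g v\<close> occurs
  once for each edge through \<open>v\<close>.\<close>

lemma sum_edges_endpoints:
  fixes g :: "'a \<Rightarrow> 'b::comm_semiring_1"
  assumes "finite_simple_graph H"
  shows "(\<Sum>e\<in>edges H. \<Sum>w\<in>e. g w) = (\<Sum>v\<in>verts H. of_nat (degree H v) * g v)"
proof -
  have "(\<Sum>e\<in>edges H. \<Sum>w\<in>e. g w) = (\<Sum>e\<in>edges H. \<Sum>w\<in>{w \<in> verts H. w \<in> e}. g w)"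
    using assms by (intro sum.cong) (auto simp: finite_simple_graph_def)
  also have "\<dots> = (\<Sum>v\<in>verts H. \<Sum>e\<in>{e \<in> edges H. v \<in> e}. g v)"
    using assms finite_edges[OF assms]
    by (intro sum.swap_restrict) (auto simp: finite_simple_graph_def)
  finally show ?thesis
    by (simp add: degree_def)
qed

text \<open>The degree of \<open>v\<close> in \<open>G\<close> is lost twice: once to its
  neighbours, once to its incident edges. Integers avoid truncated subtraction.\<close>

lemma degree_vertex_transformation:
  assumes G: "finite_simple_graph G" and v: "v \<in> verts G"
  shows "int (degree (total_transformation G Minus Plus Minus) (Inl v)) =
    int (card (edges G)) + int (card (verts G)) - 1 - 2 * int (degree G v)"
proof -
  let ?N = "{u. adjacent G v u}" and ?I = "{e \<in> edges G. v \<in> e}"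
  let ?T = "total_transformation G Minus Plus Minus"
  have fin: "finite (verts G)" "finite (edges G)"
    using G finite_edges by (auto simp: finite_simple_graph_def)
  have sub: "insert v ?N \<subseteq> verts G"
    using v adjacent_in_verts[OF G] by auto
  \<comment> \<open>\<open>v\<close> is not adjacent to itself in \<open>G\<close>, so complementing
    \<open>?N\<close> alone would keep it. Inserting \<open>v\<close> accounts for the distinctness
    condition and yields the -1.\<close>
  have "{a. adjacent ?T (Inl v) a} = (verts G - insert v ?N) <+> (edges G - ?I)"
    using v by (auto simp: adjacent_total_transformation)
  then have "degree ?T (Inl v) = card (verts G - insert v ?N) + card (edges G - ?I)"
    using fin
    by (simp add: degree_eq_card_neighbours[OF finite_simple_graph_total_transformation[OF G]]
        card_Plus)
  moreover have "int (card (verts G - insert v ?N)) = int (card (verts G)) - 1 - int (degree G v)"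
  proof -
    have "finite ?N" "v \<notin> ?N"
      using sub fin(1) not_adjacent_self[OF G] by (auto intro: finite_subset)
    then have "card (insert v ?N) = Suc (degree G v)"
      by (simp add: degree_eq_card_neighbours[OF G])
    then show ?thesis
      using card_Diff_subset[OF _ sub] card_mono[OF fin(1) sub] finite_subset[OF sub fin(1)]
      by simp
  qed
  moreover have "int (card (edges G - ?I)) = int (card (edges G)) - int (degree G v)"
    using fin(2) card_mono[of "edges G" ?I] by (simp add: degree_def card_Diff_subset)
  ultimately show ?thesis by simp
qed

text \<open>Non-incidence excludes the two ends of \<open>e\<close> among the vertices, and each end
  contributes its edges other than \<open>e\<close>. Two ends and \<open>e\<close> removed twice
  make up the 4.\<close>

lemma degree_edge_transformation:
  assumes G: "finite_simple_graph G" and e: "e \<in> edges G"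
  shows "int (degree (total_transformation G Minus Plus Minus) (Inr e)) =
    int (\<Sum>w\<in>e. degree G w) + int (card (verts G)) - 4"
proof -
  let ?I = "\<lambda>w. {f \<in> edges G. w \<in> f}"
  let ?T = "total_transformation G Minus Plus Minus"
  have fin: "finite (verts G)" "finite (edges G)"
    using G finite_edges by (auto simp: finite_simple_graph_def)
  have sub: "e \<subseteq> verts G" and card_e: "card e = 2"
    using G e by (auto simp: finite_simple_graph_def)
  then obtain u v where uv: "e = {u, v}" "u \<noteq> v"
    by (auto simp: card_2_iff)
  have "{a. adjacent ?T (Inr e) a} = (verts G - e) <+> ((?I u - {e}) \<union> (?I v - {e}))"
    using e uv(1) by (auto simp: adjacent_total_transformation)
  \<comment> \<open>No edge is counted at both ends, since \<open>e\<close> is the only edge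
    containing \<open>u\<close> and \<open>v\<close>.\<close>
  moreover have "(?I u - {e}) \<inter> (?I v - {e}) = {}"
  proof -
    have "f = e" if "f \<in> edges G" "u \<in> f" "v \<in> f" for f
      using edge_eq_doubleton[OF G that(1,2)] that(3) uv by (metis insertE singletonD)
    then show ?thesis by blast
  qed
  ultimately have "degree ?T (Inr e) = card (verts G - e) + (card (?I u - {e}) + card (?I v - {e}))"
    using fin
    by (simp add: degree_eq_card_neighbours[OF finite_simple_graph_total_transformation[OF G]]
        card_Plus card_Un_disjoint)
  moreover have "int (card (verts G - e)) = int (card (verts G)) - 2"
    using card_Diff_subset[OF _ sub] card_mono[OF fin(1) sub] finite_subset[OF sub fin(1)] card_e
    by simp
  moreover have "int (card (?I w - {e})) = int (degree G w) - 1" if "w \<in> e" for w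
  proof -
    have "e \<in> ?I w" "finite (?I w)"
      using that e fin by auto
    then show ?thesis
      using card_Suc_Diff1[of "?I w" e] by (simp add: degree_def)
  qed
  ultimately show ?thesis
    using uv by simp
qed

theorem theorem9:
  fixes G :: "'a graph" and n m :: nat
  assumes "finite_simple_graph G"
    and "connected_graph G"
    and "card (verts G) = n"
    and "card (edges G) = m"
  shows "int (F_index (total_transformation G Minus Plus Minus)) =
      (3 * int n - 20) * int (F_index G)
    + (3 * int n ^ 2 - 12 * int n + 12 * int m + 36) * int (M1 G)
    + 6 * (int n - 4) * int (M2 G)
    + int (xi4 G)
    + 3 * int (ReZG3 G)
    + (int m + int n - 1) ^ 2 * (int n * (int m + int n - 1) - 12 * int m)
    + int m * (int n - 4) ^ 3"
proof -
  note G = assms(1)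
  have fin: "finite (verts G)" "finite (edges G)"
    using G finite_edges by (auto simp: finite_simple_graph_def)
  let ?T = "total_transformation G Minus Plus Minus"
  define d where "d v = int (degree G v)" for v
  \<comment> \<open>\<open>N\<close> and \<open>c\<close> are the constant parts of the vertex
    degrees \<open>N - 2 * d v\<close> and of the edge degrees.\<close>
  define N where "N = int m + int n - 1"
  define c where "c = int n - 4"
  note endpoints = sum_edges_endpoints[OF G, where 'b = int]

  have M1: "int (M1 G) = (\<Sum>v\<in>verts G. d v ^ 2)"
    and F: "int (F_index G) = (\<Sum>v\<in>verts G. d v ^ 3)"
    by (simp_all add: M1_def F_index_def d_def)
  have handshake: "(\<Sum>v\<in>verts G. d v) = 2 * int m"
    using endpoints[of "\<lambda>_. 1"] G assms(4) by (simp add: d_def finite_simple_graph_def)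

  have "(\<Sum>v\<in>verts G. (N - 2 * d v) ^ 3) =
      (\<Sum>v\<in>verts G. N ^ 3 - 6 * N\<^sup>2 * d v + 12 * N * d v ^ 2 - 8 * d v ^ 3)"
    by (intro sum.cong) (auto simp: power2_eq_square power3_eq_cube algebra_simps)
  also have "\<dots> = int n * N ^ 3 - 12 * N\<^sup>2 * int m + 12 * N * int (M1 G) - 8 * int (F_index G)"
    by (simp add: sum.distrib sum_subtractf handshake M1 F assms(3) flip: sum_distrib_left)
  finally have vertices: "(\<Sum>v\<in>verts G. (N - 2 * d v) ^ 3) =
      int n * N ^ 3 - 12 * N\<^sup>2 * int m + 12 * N * int (M1 G) - 8 * int (F_index G)" .

  \<comment> \<open>With s = a + b, the identities s^3 = a^3 + b^3 + 3ab s and s^2 = a^2 + b^2 + 2ab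
    split the cube of s + c into summands of the indices.\<close>
  have "(\<Sum>e\<in>edges G. ((\<Sum>w\<in>e. d w) + c) ^ 3) =
      (\<Sum>e\<in>edges G. (\<Sum>w\<in>e. d w ^ 3) + 3 * ((\<Prod>w\<in>e. d w) * (\<Sum>w\<in>e. d w))
         + 3 * c * ((\<Sum>w\<in>e. d w ^ 2) + 2 * (\<Prod>w\<in>e. d w)) + 3 * c\<^sup>2 * (\<Sum>w\<in>e. d w) + c ^ 3)"
  proof (intro sum.cong refl)
    fix e assume "e \<in> edges G"
    then obtain u v where "e = {u, v}" "u \<noteq> v"
      using G by (auto simp: finite_simple_graph_def card_2_iff)
    then show "((\<Sum>w\<in>e. d w) + c) ^ 3 =
      (\<Sum>w\<in>e. d w ^ 3) + 3 * ((\<Prod>w\<in>e. d w) * (\<Sum>w\<in>e. d w))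
         + 3 * c * ((\<Sum>w\<in>e. d w ^ 2) + 2 * (\<Prod>w\<in>e. d w)) + 3 * c\<^sup>2 * (\<Sum>w\<in>e. d w) + c ^ 3"
      by (simp add: power2_eq_square power3_eq_cube algebra_simps)
  qed
  also have "\<dots> = (\<Sum>e\<in>edges G. \<Sum>w\<in>e. d w ^ 3) + 3 * int (ReZG3 G)
      + 3 * c * ((\<Sum>e\<in>edges G. \<Sum>w\<in>e. d w ^ 2) + 2 * int (M2 G))
      + 3 * c\<^sup>2 * (\<Sum>e\<in>edges G. \<Sum>w\<in>e. d w) + int m * c ^ 3"
    by (simp add: sum.distrib ReZG3_def M2_def d_def assms(4) flip: sum_distrib_left)
  \<comment> \<open>In these three sums \<open>endpoints\<close> supplies one extra factor
    \<open>d v\<close>, raising each exponent by one.\<close>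
  also have "(\<Sum>e\<in>edges G. \<Sum>w\<in>e. d w ^ 3) = int (xi4 G)"
    by (simp add: endpoints xi4_def d_def eval_nat_numeral)
  also have "(\<Sum>e\<in>edges G. \<Sum>w\<in>e. d w ^ 2) = int (F_index G)"
    by (simp add: endpoints F_index_def d_def eval_nat_numeral)
  also have "(\<Sum>e\<in>edges G. \<Sum>w\<in>e. d w) = int (M1 G)"
    by (simp add: endpoints M1_def d_def eval_nat_numeral)
  finally have edges: "(\<Sum>e\<in>edges G. ((\<Sum>w\<in>e. d w) + c) ^ 3) =
      int (xi4 G) + 3 * int (ReZG3 G) + 3 * c * (int (F_index G) + 2 * int (M2 G))
      + 3 * c\<^sup>2 * int (M1 G) + int m * c ^ 3" .

  have "int (F_index ?T) = (\<Sum>a\<in>verts G <+> edges G. int (degree ?T a) ^ 3)"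
    by (simp add: F_index_def total_transformation_def)
  also have "\<dots> = (\<Sum>v\<in>verts G. int (degree ?T (Inl v)) ^ 3)
      + (\<Sum>e\<in>edges G. int (degree ?T (Inr e)) ^ 3)"
    using fin by (simp add: sum.Plus)
  also have "\<dots> = (\<Sum>v\<in>verts G. (N - 2 * d v) ^ 3) + (\<Sum>e\<in>edges G. ((\<Sum>w\<in>e. d w) + c) ^ 3)"
    using G assms(3,4)
    by (intro arg_cong2[where f = "(+)"] sum.cong)
      (simp_all add: degree_vertex_transformation degree_edge_transformation d_def N_def c_def
        add_diff_eq)
  \<comment> \<open>Both parts contribute to \<open>F_index G\<close>, with coefficient 3c - 8 = 3n
    - 20, and to \<open>M1 G\<close>, with coefficient 12N + 3c^2.\<close>
  finally show ?thesis
    unfolding vertices edges unfolding N_def c_def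
    by (simp add: power2_eq_square power3_eq_cube algebra_simps)
qed

end
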